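(* Let $\overline{x}\in S=\{x\in\mathbb{R}^N : \|x\|_0\le s\}$ and let $\Gamma=\mathrm{supp}(\overline{x})$. Then the Clarke tangent cone of $S$ at $\overline{x}$ and the corresponding normal cone are $$T^C_S(\overline{x})=\{d\in\mathbb{R}^N : \mathrm{supp}(d)\subseteq\Gamma\}=\mathrm{span}\{e_i : i\in\Gamma\},\qquad N^C_S(\overline{x})=\mathrm{span}\{e_i : i\notin\Gamma\}.$$
   Context: $N$ and $s$ are positive integers with $s<N$. For $x\in\mathbb{R}^N$, $\mathrm{supp}(x)=\{i\in\{1,\dots,N\} : x_i\neq0\}$ and $\|x\|_0=|\mathrm{supp}(x)|$. $e_i\in\mathbb{R}^N$ is the $i$-th standard basis vector. For a nonempty set $\Omega\subseteq\mathbb{R}^N$ and $\overline{x}\in\Omega$, the Clarke tangent cone $T^C_\Omega(\overline{x})$ is the set of all $d\in\mathbb{R}^N$ such that for every sequence $\{x^k\}\subset\Omega$ with $\lim_{k\to\infty}x^k=\overline{x}$ and every sequence $\{\lambda_k\}\subset\mathbb{R}_+$ with $\lim_{k\to\infty}\lambda_k=0$ there exists a sequence $\{y^k\}\subset\mathbb{R}^N$ with $\lim_{k\to\infty}y^k=d$ and $x^k+\lambda_k y^k\in\Omega$ for $k=1,2,\dots$. The corresponding normal cone is $N^C_\Omega(\overline{x})=\{d\in\mathbb{R}^N : \langle d,z\rangle\le0\ \ \forall z\in T^C_\Omega(\overline{x})\}$. *)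

theory Defs
  imports "HOL-Analysis.Analysis"
begin

text \<open>Euclidean space of dimension N is \<open>real ^ 'n\<close> with N = CARD('n); its i-th standard
  basis vector is \<open>axis i 1\<close>.\<close>

definition supp :: "real ^ 'n \<Rightarrow> 'n set" where
  "supp x = {i. x $ i \<noteq> 0}"

definition l0_norm :: "real ^ 'n \<Rightarrow> nat" where
  "l0_norm x = card (supp x)"

definition sparse_set :: "nat \<Rightarrow> (real ^ 'n) set" where
  "sparse_set s = {x. l0_norm x \<le> s}"

text \<open>Meaningful for \<open>x \<in> \<Omega>\<close>. The step sizes range over the nonnegative reals; a zero step only
  asks for \<open>xs k \<in> \<Omega>\<close>, so requiring positive steps would give the same cone.\<close>

definition clarke_tangent_cone :: "'a::real_normed_vector set \<Rightarrow> 'a \<Rightarrow> 'a set" where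
  "clarke_tangent_cone \<Omega> x = {d.
     \<forall>(xs :: nat \<Rightarrow> 'a) (l :: nat \<Rightarrow> real).
       (\<forall>k. xs k \<in> \<Omega>) \<longrightarrow> xs \<longlonglongrightarrow> x \<longrightarrow> (\<forall>k. l k \<ge> 0) \<longrightarrow> l \<longlonglongrightarrow> 0 \<longrightarrow>
       (\<exists>ys :: nat \<Rightarrow> 'a. ys \<longlonglongrightarrow> d \<and> (\<forall>k. xs k + l k *\<^sub>R ys k \<in> \<Omega>))}"

definition clarke_normal_cone :: "'a::real_inner set \<Rightarrow> 'a \<Rightarrow> 'a set" where
  "clarke_normal_cone \<Omega> x = {d. \<forall>z \<in> clarke_tangent_cone \<Omega> x. d \<bullet> z \<le> 0}"

end

theory Submission
  imports Defs
begin

text \<open>Near \<open>x\<close> no coordinate of \<open>supp x\<close> can vanish, so moving along a vector supported in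
  \<open>supp x\<close> never enlarges the support of a nearby sparse point. Conversely, if \<open>d $ i \<noteq> 0\<close> with
  \<open>i \<notin> supp x\<close>, then \<open>x\<close> is approached by points whose support is a fixed set of exactly \<open>s\<close>
  indices that avoids \<open>i\<close>; steps that are short compared with the distance to \<open>x\<close> keep these
  \<open>s\<close> entries nonzero, and a step in a direction close to \<open>d\<close> creates one more.\<close>

lemma supp_subset_iff: "supp d \<subseteq> A \<longleftrightarrow> (\<forall>i. i \<notin> A \<longrightarrow> d $ i = 0)"
  by (auto simp: supp_def)

text \<open>The index set is arbitrary because the result serves twice: with \<open>supp x\<close>
  for the tangent cone and with \<open>- supp x\<close> for the normal cone.\<close>

lemma supp_subset_eq_span_axis:
  fixes A :: "'n::finite set"
  shows "{d :: real ^ 'n. supp d \<subseteq> A} = span {axis i 1 | i. i \<in> A}"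
proof
  show "{d :: real ^ 'n. supp d \<subseteq> A} \<subseteq> span {axis i 1 | i. i \<in> A}"
  proof
    fix d :: "real ^ 'n" assume d: "d \<in> {d. supp d \<subseteq> A}"
    have "(d $ i) *\<^sub>R axis i 1 \<in> span {axis i (1::real) | i. i \<in> A}" for i
    proof (cases "i \<in> A")
      case True
      then show ?thesis by (intro span_mul span_base) auto
    next
      case False
      with d have "d $ i = 0" by (auto simp: supp_def)
      then show ?thesis by (simp add: span_zero)
    qed
    then have "(\<Sum>i\<in>UNIV. (d $ i) *\<^sub>R axis i 1) \<in> span {axis i (1::real) | i. i \<in> A}"
      by (intro span_sum)
    then show "d \<in> span {axis i 1 | i. i \<in> A}"
      using basis_expansion[of d] by (simp add: scalar_mult_eq_scaleR)
  qed
  have "subspace {d :: real ^ 'n. supp d \<subseteq> A}"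
    by (auto simp: subspace_def supp_subset_iff)
  then show "span {axis i 1 | i. i \<in> A} \<subseteq> {d :: real ^ 'n. supp d \<subseteq> A}"
    by (intro span_minimal) (auto simp: supp_def axis_def split: if_splits)
qed

text \<open>A coordinate with nonzero limit is eventually nonzero, and since there are finitely many
  coordinates, one threshold works for all of them.\<close>

lemma eventually_supp_superset:
  fixes x :: "real ^ 'n::finite"
  assumes "xs \<longlonglongrightarrow> x"
  shows "\<forall>\<^sub>F k in sequentially. supp x \<subseteq> supp (xs k)"
proof -
  have "\<forall>\<^sub>F k in sequentially. i \<in> supp x \<longrightarrow> i \<in> supp (xs k)" for i
  proof (cases "x $ i = 0")
    case False
    have "(\<lambda>k. xs k $ i) \<longlonglongrightarrow> x $ i"
      using assms by (intro tendsto_intros)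
    from tendsto_imp_eventually_ne[OF this False] show ?thesis
      by (auto simp: supp_def elim: eventually_mono)
  qed (simp add: supp_def)
  then have "\<forall>\<^sub>F k in sequentially. \<forall>i. i \<in> supp x \<longrightarrow> i \<in> supp (xs k)"
    by (simp add: eventually_all_finite)
  then show ?thesis by (auto elim: eventually_mono)
qed

lemma clarke_tangent_cone_sparse_set_superset:
  fixes x d :: "real ^ 'n::finite"
  assumes "supp d \<subseteq> supp x"
  shows "d \<in> clarke_tangent_cone (sparse_set s) x"
  unfolding clarke_tangent_cone_def
proof (intro CollectI allI impI)
  fix xs :: "nat \<Rightarrow> real ^ 'n" and l :: "nat \<Rightarrow> real"
  assume xs: "\<forall>k. xs k \<in> sparse_set s" and lim: "xs \<longlonglongrightarrow> x"
  \<comment> \<open>Membership is demanded for every \<open>k\<close>, not only for large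
    \<open>k\<close>. Before \<open>supp (xs k)\<close> has caught up with \<open>supp x\<close>, a
    step along \<open>d\<close> might leave the set, so the default direction is
    \<open>0\<close>.\<close>
  let ?ys = "\<lambda>k. if supp x \<subseteq> supp (xs k) then d else 0"
  have "\<forall>\<^sub>F k in sequentially. ?ys k = d"
    using eventually_supp_superset[OF lim] by eventually_elim simp
  then have "?ys \<longlonglongrightarrow> d" by (rule tendsto_eventually)
  moreover have "xs k + l k *\<^sub>R ?ys k \<in> sparse_set s" for k
  proof -
    have "supp (xs k + l k *\<^sub>R ?ys k) \<subseteq> supp (xs k)"
      using assms by (auto simp: supp_subset_iff) (auto simp: supp_def)
    then have "card (supp (xs k + l k *\<^sub>R ?ys k)) \<le> card (supp (xs k))"
      by (intro card_mono) auto
    also have "\<dots> \<le> s" using xs by (simp add: sparse_set_def l0_norm_def)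
    finally show ?thesis by (simp add: sparse_set_def l0_norm_def)
  qed
  ultimately show "\<exists>ys. ys \<longlonglongrightarrow> d \<and> (\<forall>k. xs k + l k *\<^sub>R ys k \<in> sparse_set s)" by blast
qed

lemma clarke_tangent_cone_sparse_set_subset:
  fixes x d :: "real ^ 'n::finite"
  assumes "s < CARD('n)" "x \<in> sparse_set s"
    and d: "d \<in> clarke_tangent_cone (sparse_set s) x"
  shows "supp d \<subseteq> supp x"
proof (rule ccontr)
  assume "\<not> supp d \<subseteq> supp x"
  then obtain i where i: "d $ i \<noteq> 0" "x $ i = 0" by (auto simp: supp_def)
  \<comment> \<open>Since \<open>s < CARD('n)\<close>, removing \<open>i\<close> still leaves at
    least \<open>s\<close> indices, so \<open>supp x\<close> can be enlarged to exactly
    \<open>s\<close> indices without using \<open>i\<close>.\<close>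
  have "card (supp x) \<le> s" using assms(2) by (simp add: sparse_set_def l0_norm_def)
  moreover have "s \<le> card (UNIV - {i})" using assms(1) by (simp add: card_Diff_singleton)
  moreover have "supp x \<subseteq> UNIV - {i}" using i by (auto simp: supp_def)
  ultimately obtain T where T: "supp x \<subseteq> T" "T \<subseteq> UNIV - {i}" "card T = s"
    using exists_subset_between[of "supp x" s "UNIV - {i}"] by auto
  define e :: "nat \<Rightarrow> real" where "e k = inverse (real (Suc k))" for k
  define u :: "real ^ 'n" where "u = (\<chi> j. if j \<in> T - supp x then 1 else 0)"
  have e0: "e \<longlonglongrightarrow> 0" and epos: "e k > 0" for k
    unfolding e_def by (rule LIMSEQ_inverse_real_of_nat) simp
  \<comment> \<open>The step size is the square of the distance scale \<open>e k\<close>, so the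
    moved point is \<open>x + e k *\<^sub>R (u + e k *\<^sub>R ys k)\<close>: the bracket tends to
    \<open>u\<close>, and the step cannot cancel the entries that \<open>u\<close> has
    created.\<close>
  let ?xs = "\<lambda>k. x + e k *\<^sub>R u" and ?l = "\<lambda>k. e k * e k"
  have "supp (?xs k) \<subseteq> T" for k
    using T(1) by (auto simp: supp_def u_def split: if_splits)
  then have "?xs k \<in> sparse_set s" for k
    using T(3) card_mono[of T "supp (?xs k)"] by (simp add: sparse_set_def l0_norm_def)
  moreover have "?xs \<longlonglongrightarrow> x" "?l \<longlonglongrightarrow> 0"
    by (auto intro!: tendsto_eq_intros e0)
  moreover have "?l k \<ge> 0" for k by simp
  ultimately obtain ys where ys: "ys \<longlonglongrightarrow> d" "\<And>k. ?xs k + ?l k *\<^sub>R ys k \<in> sparse_set s"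
    using d[unfolded clarke_tangent_cone_def mem_Collect_eq, rule_format, of ?xs ?l] by blast
  \<comment> \<open>Three limits protect three groups of entries: the moved points tend to
    \<open>x\<close> (entries in \<open>supp x\<close>), the brackets to \<open>u\<close> (entries
    in \<open>T - supp x\<close>), and \<open>ys\<close> to \<open>d\<close> (entry
    \<open>i\<close>).\<close>
  have "(\<lambda>k. ?xs k + ?l k *\<^sub>R ys k) \<longlonglongrightarrow> x"
    by (auto intro!: tendsto_eq_intros e0 ys(1))
  from eventually_supp_superset[OF this]
  have "\<forall>\<^sub>F k in sequentially. supp x \<subseteq> supp (?xs k + ?l k *\<^sub>R ys k)" .
  moreover
  have "(\<lambda>k. u + e k *\<^sub>R ys k) \<longlonglongrightarrow> u"
    by (auto intro!: tendsto_eq_intros e0 ys(1))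
  note eventually_supp_superset[OF this]
  moreover note eventually_supp_superset[OF ys(1)]
  ultimately have "\<forall>\<^sub>F k in sequentially. insert i T \<subseteq> supp (?xs k + ?l k *\<^sub>R ys k)"
  proof eventually_elim
    case (elim k)
    have "j \<in> supp (?xs k + ?l k *\<^sub>R ys k)" if j: "j \<in> T - supp x" for j
    proof -
      have "(?xs k + ?l k *\<^sub>R ys k) $ j = e k * (u + e k *\<^sub>R ys k) $ j"
        using j by (simp add: supp_def algebra_simps)
      moreover have "(u + e k *\<^sub>R ys k) $ j \<noteq> 0"
      proof -
        have "j \<in> supp u" using j by (simp add: supp_def u_def)
        with elim(2) show ?thesis by (auto simp: supp_def)
      qed
      ultimately show ?thesis using epos[of k] by (simp add: supp_def)
    qed
    moreover have "i \<in> supp (?xs k + ?l k *\<^sub>R ys k)"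
    proof -
      \<comment> \<open>Both \<open>x\<close> and \<open>u\<close> vanish at \<open>i\<close>, so
        this entry is \<open>e k * e k * ys k $ i\<close>, a product of nonzero factors.\<close>
      have "u $ i = 0" using T(2) by (auto simp: u_def)
      moreover have "ys k $ i \<noteq> 0" using elim(3) i(1) by (auto simp: supp_def)
      ultimately show ?thesis using i(2) epos[of k] by (simp add: supp_def)
    qed
    ultimately show ?case using elim(1) by blast
  qed
  then obtain k where "insert i T \<subseteq> supp (?xs k + ?l k *\<^sub>R ys k)"
    using eventually_happens'[OF sequentially_bot] by blast
  then have "card (insert i T) \<le> card (supp (?xs k + ?l k *\<^sub>R ys k))"
    by (intro card_mono) auto
  also have "\<dots> \<le> s" using ys(2)[of k] by (simp add: sparse_set_def l0_norm_def)
  \<comment> \<open>As \<open>i\<close> lies outside \<open>T\<close>, the left-hand side is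
    \<open>s + 1\<close>.\<close>
  finally show False using T(2,3) by (simp add: card_insert_if split: if_splits) blast
qed

text \<open>The polar of a linear subspace is its orthogonal complement, which for a coordinate
  subspace is spanned by the remaining axes.\<close>

lemma polar_supp_subset:
  fixes A :: "'n::finite set"
  shows "{d :: real ^ 'n. \<forall>z \<in> {z. supp z \<subseteq> A}. d \<bullet> z \<le> 0} = {d. supp d \<subseteq> - A}"
proof (intro equalityI subsetI CollectI)
  fix d :: "real ^ 'n" and i
  assume d: "d \<in> {d. \<forall>z \<in> {z. supp z \<subseteq> A}. d \<bullet> z \<le> 0}" and i: "i \<in> supp d"
  \<comment> \<open>Testing against the \<open>i\<close>-th component of \<open>d\<close> itself
    gives the square of \<open>d $ i\<close>, which is positive.\<close>
  have "\<not> d \<bullet> axis i (d $ i) \<le> 0"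
    using i by (auto simp: inner_axis supp_def not_le zero_less_mult_iff)
  moreover have "supp (axis i (d $ i)) \<subseteq> {i}" by (auto simp: supp_def axis_def)
  ultimately show "i \<in> - A" using d by auto
next
  fix d :: "real ^ 'n"
  assume d: "d \<in> {d. supp d \<subseteq> - A}"
  show "\<forall>z \<in> {z. supp z \<subseteq> A}. d \<bullet> z \<le> 0"
  proof
    fix z :: "real ^ 'n" assume "z \<in> {z. supp z \<subseteq> A}"
    then have "\<forall>i. d $ i * z $ i = 0" using d by (auto simp: supp_def)
    then show "d \<bullet> z \<le> 0" unfolding inner_vec_def inner_real_def by (intro sum_nonpos) (metis order_refl)
  qed
qed

theorem theorem2p2:
  fixes s :: nat and x :: "real ^ 'n"
  assumes "0 < s" and "s < CARD('n)"
    and "x \<in> sparse_set s"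
  shows "clarke_tangent_cone (sparse_set s) x = {d. supp d \<subseteq> supp x}
    \<and> {d :: real ^ 'n. supp d \<subseteq> supp x} = span {axis i 1 | i. i \<in> supp x}
    \<and> clarke_normal_cone (sparse_set s) x = span {axis i 1 | i. i \<notin> supp x}"
proof -
  have T: "clarke_tangent_cone (sparse_set s) x = {d. supp d \<subseteq> supp x}"
    using clarke_tangent_cone_sparse_set_superset
      clarke_tangent_cone_sparse_set_subset[OF assms(2,3)] by blast
  have "clarke_normal_cone (sparse_set s) x = span {axis i 1 | i. i \<in> - supp x}"
    unfolding clarke_normal_cone_def T polar_supp_subset by (rule supp_subset_eq_span_axis)
  with T show ?thesis by (simp add: supp_subset_eq_span_axis)
qed

end
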